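(* Let $S$ be a Tychonoff semitopological monoid such that $(S,S)$ is a Grothendieck pair, and let $G$ be a subgroup of $S$. Then $G$, with the subspace topology, is a topological group.
   Context: A semitopological monoid is a semigroup with an identity, endowed with a topology such that the multiplication is separately continuous (continuous in each variable when the other is fixed). A subgroup of a semigroup $S$ is a subset that is a group under the multiplication of $S$. $C_p(Y)$ is the space of real-valued continuous functions on $Y$ with the topology of pointwise convergence. A pair of topological spaces $(X,Y)$ is a Grothendieck pair if for each continuous map $f : X\to C_p(Y)$ the closure $\overline{f(X)}$ of $f(X)$ in $C_p(Y)$ is compact. *)

theory Defs
  imports "HOL-Algebra.Group" "HOL-Analysis.Analysis"
begin

definition tychonoff_space :: "'a topology \<Rightarrow> bool" where
  "tychonoff_space X \<longleftrightarrow> completely_regular_space X \<and> Hausdorff_space X"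

text \<open>The points of \<open>Cp Y\<close> are the continuous real functions on \<open>Y\<close>, each represented by its
  unique extension that is \<open>undefined\<close> outside \<open>topspace Y\<close> (the convention of
  \<^const>\<open>product_topology\<close>).\<close>

definition Cp :: "'a topology \<Rightarrow> ('a \<Rightarrow> real) topology" where
  "Cp Y = subtopology (product_topology (\<lambda>_. euclideanreal) (topspace Y))
            {f. continuous_map Y euclideanreal f}"

definition grothendieck_pair :: "'a topology \<Rightarrow> 'b topology \<Rightarrow> bool" where
  "grothendieck_pair X Y \<longleftrightarrow>
     (\<forall>f. continuous_map X (Cp Y) f \<longrightarrow> compactin (Cp Y) (Cp Y closure_of (f ` topspace X)))"

locale semitopological_monoid = monoid S
  for S :: "('a, 'm) monoid_scheme" (structure) and X :: "'a topology" +
  assumes topspace_eq: "topspace X = carrier S"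
    and continuous_left_mult: "a \<in> carrier S \<Longrightarrow> continuous_map X X (\<lambda>x. a \<otimes> x)"
    and continuous_right_mult: "a \<in> carrier S \<Longrightarrow> continuous_map X X (\<lambda>x. x \<otimes> a)"

locale topological_group = group G
  for G :: "('a, 'm) monoid_scheme" (structure) and X :: "'a topology" +
  assumes topspace_eq: "topspace X = carrier G"
    and continuous_mult: "continuous_map (prod_topology X X) X (\<lambda>(x, y). x \<otimes> y)"
    and continuous_inv: "continuous_map X X (\<lambda>x. inv x)"

text \<open>A subgroup in the sense of semigroup theory. Its identity \<open>e\<close> is an idempotent of \<open>S\<close>
  determined by \<open>H\<close>, in general different from \<open>\<one>\<^bsub>S\<^esub>\<close>; the library predicate \<^const>\<open>subgroup\<close>
  would force \<open>e = \<one>\<^bsub>S\<^esub>\<close>.\<close>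

definition semigroup_subgroup :: "'a set \<Rightarrow> 'a \<Rightarrow> ('a, 'm) monoid_scheme \<Rightarrow> bool" where
  "semigroup_subgroup H e S \<longleftrightarrow> H \<subseteq> carrier S \<and> group (S\<lparr>carrier := H, one := e\<rparr>)"

end

theory Submission
  imports Defs
begin

text \<open>Let \<open>f\<close> be a continuous real function on \<open>S\<close>. A Cantor scheme argument shows that the
  orbit map \<open>x \<mapsto> f (x \<cdot>)\<close> has arbitrarily small oscillation in the uniform norm on some nonempty
  relatively open subset of \<open>G\<close>: otherwise one gets continuum many cluster points
  of the orbit that are uniformly separated, whereas all of them are uniformly continuous with
  respect to one countable family of functions \<open>f (x\<^sub>s \<cdot>)\<close>, which has a compact metrizable image
  because \<open>S\<close> is pseudocompact. Translating by group elements moves this open set to \<open>e\<close>, so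
  \<open>f (v y) - f y\<close> is small uniformly in \<open>y \<in> G\<close> when \<open>v\<close> is near \<open>e\<close>. This yields joint continuity
  of the product and continuity of the inverse.\<close>

section \<open>Pseudocompactness and maps into \<open>Cp\<close>\<close>

definition pseudocompact_space :: "'a topology \<Rightarrow> bool" where
  "pseudocompact_space X \<longleftrightarrow>
     (\<forall>f. continuous_map X euclideanreal f \<longrightarrow> bounded (f ` topspace X))"

lemma topspace_Cp:
  "topspace (Cp Y) = extensional (topspace Y) \<inter> {f. continuous_map Y euclideanreal f}"
  by (auto simp: Cp_def PiE_def)

lemma continuous_map_Cp_eval:
  assumes "y \<in> topspace Y"
  shows "continuous_map (Cp Y) euclideanreal (\<lambda>f. f y)"
  unfolding Cp_def
  by (intro continuous_map_from_subtopology continuous_map_product_projection assms)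

text \<open>The pointwise topology asks for nothing beyond separate continuity.
  \<open>restrict\<close> produces the extensional representative that a point of
  \<open>Cp Y\<close> has to be.\<close>

lemma continuous_map_into_Cp:
  assumes "\<And>x. x \<in> topspace X \<Longrightarrow> continuous_map Y euclideanreal (f x)"
    and "\<And>y. y \<in> topspace Y \<Longrightarrow> continuous_map X euclideanreal (\<lambda>x. f x y)"
  shows "continuous_map X (Cp Y) (\<lambda>x. restrict (f x) (topspace Y))"
  unfolding Cp_def continuous_map_in_subtopology
proof (intro conjI)
  show "continuous_map X (product_topology (\<lambda>_. euclideanreal) (topspace Y))
          (\<lambda>x. restrict (f x) (topspace Y))"
    unfolding continuous_map_componentwise using assms(2) by auto
  show "(\<lambda>x. restrict (f x) (topspace Y)) \<in> topspace X \<rightarrow> {f. continuous_map Y euclideanreal f}"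
  proof
    fix x assume "x \<in> topspace X"
    then show "restrict (f x) (topspace Y) \<in> {f. continuous_map Y euclideanreal f}"
      using continuous_map_eq[OF assms(1)] by simp
  qed
qed

text \<open>A real function \<open>g\<close> on \<open>X\<close> is encoded by constant functions on
  \<open>Y\<close>. Evaluation at one point of \<open>Y\<close> then maps a compact closure onto a
  compact set of reals that contains the range of \<open>g\<close>.\<close>

lemma grothendieck_pair_imp_pseudocompact:
  assumes "grothendieck_pair X Y" and "topspace Y \<noteq> {}"
  shows "pseudocompact_space X"
  unfolding pseudocompact_space_def
proof (intro allI impI)
  fix g assume g: "continuous_map X euclideanreal g"
  obtain y where y: "y \<in> topspace Y" using assms(2) by blast
  define F where "F = (\<lambda>x. restrict (\<lambda>_. g x) (topspace Y))"
  have F: "continuous_map X (Cp Y) F"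
    unfolding F_def by (rule continuous_map_into_Cp) (use g in auto)
  have "compactin (Cp Y) (Cp Y closure_of (F ` topspace X))"
    using assms(1) F unfolding grothendieck_pair_def by blast
  then have "compactin euclideanreal ((\<lambda>h. h y) ` (Cp Y closure_of (F ` topspace X)))"
    by (rule image_compactin) (rule continuous_map_Cp_eval[OF y])
  then have b: "bounded ((\<lambda>h. h y) ` (Cp Y closure_of (F ` topspace X)))"
    by (simp add: compact_imp_bounded)
  have "F ` topspace X \<subseteq> Cp Y closure_of (F ` topspace X)"
    by (rule closure_of_subset) (use continuous_map_image_subset_topspace[OF F] in blast)
  then have "(\<lambda>h. h y) ` F ` topspace X \<subseteq> (\<lambda>h. h y) ` (Cp Y closure_of (F ` topspace X))"
    by (rule image_mono)
  moreover have "(\<lambda>h. h y) ` F ` topspace X = g ` topspace X"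
    using y by (auto simp: F_def image_image)
  ultimately show "bounded (g ` topspace X)"
    using b bounded_subset by metis
qed

section \<open>Countable families of functions on a pseudocompact space\<close>

text \<open>Bounds on the single coordinates put the image into a box, compact by Tychonoff's
  theorem. The image is closed in it: the countable product is metrizable, and for a limit point
  \<open>c\<close> that is not attained the reciprocal of the distance to \<open>c\<close> would be
  an unbounded continuous function on \<open>X\<close>.\<close>

lemma pseudocompact_space_compact_image:
  fixes \<phi> :: "nat \<Rightarrow> 'a \<Rightarrow> real"
  assumes X: "pseudocompact_space X"
    and \<phi>: "\<And>i. continuous_map X euclideanreal (\<phi> i)"
  shows "compact ((\<lambda>x i. \<phi> i x) ` topspace X)"
proof -
  let ?\<Phi> = "\<lambda>x i. \<phi> i x"
  have cont: "continuous_map X euclidean ?\<Phi>"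
    unfolding euclidean_product_topology[symmetric] continuous_map_componentwise_UNIV
    using \<phi> by simp
  have "\<exists>B. \<forall>x\<in>topspace X. \<bar>\<phi> i x\<bar> \<le> B" for i
    using X \<phi>[of i] by (force simp: pseudocompact_space_def bounded_iff)
  then obtain B where B: "\<And>i x. x \<in> topspace X \<Longrightarrow> \<bar>\<phi> i x\<bar> \<le> B i"
    by metis
  have "compactin (product_topology (\<lambda>_. euclideanreal) UNIV) (\<Pi>\<^sub>E i\<in>UNIV. {- B i..B i})"
    by (subst compactin_PiE) auto
  then have K: "compact (\<Pi>\<^sub>E i\<in>UNIV. {- B i..B i})"
    by (simp add: euclidean_product_topology)
  have sub: "?\<Phi> ` topspace X \<subseteq> (\<Pi>\<^sub>E i\<in>UNIV. {- B i..B i})"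
  proof (intro image_subsetI PiE_I)
    fix x i assume "x \<in> topspace X"
    then show "\<phi> i x \<in> {- B i..B i}" using B[of x i] by (simp add: abs_le_iff)
  qed simp
  have "closed (?\<Phi> ` topspace X)"
  proof (rule ccontr)
    assume "\<not> closed (?\<Phi> ` topspace X)"
    then obtain c where c: "c \<in> closure (?\<Phi> ` topspace X)" "c \<notin> ?\<Phi> ` topspace X"
      using closure_subset_eq by blast
    have ne: "dist (?\<Phi> x) c \<noteq> 0" if "x \<in> topspace X" for x
      using c(2) that by auto
    have "continuous_map euclidean euclideanreal (\<lambda>z. dist z c)"
      by (simp add: continuous_on_dist)
    then have "continuous_map X euclideanreal (\<lambda>x. dist (?\<Phi> x) c)"
      using continuous_map_compose[OF cont, of euclideanreal "\<lambda>z. dist z c"] by (simp add: comp_def)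
    then have "continuous_map X euclideanreal (\<lambda>x. inverse (dist (?\<Phi> x) c))"
      by (rule continuous_map_real_inverse) (rule ne)
    then obtain M where M: "\<And>x. x \<in> topspace X \<Longrightarrow> \<bar>inverse (dist (?\<Phi> x) c)\<bar> \<le> M"
      using X by (force simp: pseudocompact_space_def bounded_iff)
    obtain x where x: "x \<in> topspace X" "dist (?\<Phi> x) c < inverse (\<bar>M\<bar> + 1)"
      using c(1) unfolding closure_approachable
      by (metis (no_types, lifting) abs_ge_zero add_nonneg_pos imageE inverse_positive_iff_positive
          zero_less_one)
    have "0 < dist (?\<Phi> x) c" using ne[OF x(1)] by (metis zero_le_dist less_le)
    then have "\<bar>M\<bar> + 1 < inverse (dist (?\<Phi> x) c)"
      using x(2) less_imp_inverse_less by fastforce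
    then show False using M[OF x(1)] by linarith
  qed
  then show ?thesis
    using K sub compact_Int_closed by (metis inf.absorb_iff2)
qed

text \<open>By compactness, counterexamples for all \<open>n\<close> accumulate at two points of
  \<open>X\<close> where all \<open>\<phi> i\<close> agree while \<open>g\<close> still differs by
  at least \<open>\<epsilon>\<close>.\<close>

lemma pseudocompact_space_uniform_modulus:
  fixes \<phi> :: "nat \<Rightarrow> 'a \<Rightarrow> real" and g :: "'a \<Rightarrow> real"
  assumes X: "pseudocompact_space X"
    and \<phi>: "\<And>i. continuous_map X euclideanreal (\<phi> i)"
    and g: "continuous_map X euclideanreal g"
    and determined: "\<And>x y. \<lbrakk>x \<in> topspace X; y \<in> topspace X; \<And>i. \<phi> i x = \<phi> i y\<rbrakk> \<Longrightarrow> g x = g y"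
    and "\<epsilon> > 0"
  obtains n where "\<And>x y. \<lbrakk>x \<in> topspace X; y \<in> topspace X;
      \<And>i. i < Suc n \<Longrightarrow> \<bar>\<phi> i x - \<phi> i y\<bar> < inverse (Suc n)\<rbrakk> \<Longrightarrow> \<bar>g x - g y\<bar> < \<epsilon>"
proof (rule ccontr)
  assume "\<not> thesis"
  then have "\<forall>n. \<exists>x y. x \<in> topspace X \<and> y \<in> topspace X \<and>
      (\<forall>i<Suc n. \<bar>\<phi> i x - \<phi> i y\<bar> < inverse (Suc n)) \<and> \<bar>g x - g y\<bar> \<ge> \<epsilon>"
    using that by (meson not_le)
  then obtain x y where x: "\<And>n. x n \<in> topspace X" and y: "\<And>n. y n \<in> topspace X"
    and close: "\<And>n i. i < Suc n \<Longrightarrow> \<bar>\<phi> i (x n) - \<phi> i (y n)\<bar> < inverse (Suc n)"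
    and far: "\<And>n. \<bar>g (x n) - g (y n)\<bar> \<ge> \<epsilon>"
    by metis
  \<comment> \<open>Adding \<open>g\<close> as coordinate 0 makes one compact image control the
    limits of \<open>g\<close> along with those of all \<open>\<phi> i\<close>;
    \<open>\<phi> i\<close> moves to index \<open>Suc i\<close>.\<close>
  define \<psi> where "\<psi> = case_nat g \<phi>"
  have \<psi>: "continuous_map X euclideanreal (\<psi> i)" for i
    using \<phi> g by (cases i) (auto simp: \<psi>_def)
  define \<Psi> where "\<Psi> = (\<lambda>x i. \<psi> i x)"
  have K: "compact (\<Psi> ` topspace X)"
    unfolding \<Psi>_def by (rule pseudocompact_space_compact_image[OF X \<psi>])
  obtain a r where a: "a \<in> topspace X" and r: "strict_mono r"
    and lima: "(\<lambda>n. \<Psi> (x (r n))) \<longlonglongrightarrow> \<Psi> a"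
    using K[unfolded compact_def, rule_format, of "\<lambda>n. \<Psi> (x n)"] x by (auto simp: comp_def)
  \<comment> \<open>The second extraction starts from the subsequence \<open>r\<close>, so that
    \<open>r \<circ> q\<close> works for both sequences.\<close>
  obtain b q where b: "b \<in> topspace X" and q: "strict_mono q"
    and limb: "(\<lambda>n. \<Psi> (y (r (q n)))) \<longlonglongrightarrow> \<Psi> b"
    using K[unfolded compact_def, rule_format, of "\<lambda>n. \<Psi> (y (r n))"] y by (auto simp: comp_def)
  define s where "s = r \<circ> q"
  have s: "strict_mono s" unfolding s_def using r q by (rule strict_mono_o)
  have coord: "(\<lambda>n. h n i) \<longlonglongrightarrow> l i" if "h \<longlonglongrightarrow> l" for h :: "nat \<Rightarrow> nat \<Rightarrow> real" and l i
    using isCont_tendsto_compose[of l "\<lambda>u. u i", OF _ that]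
      continuous_on_product_coordinates[of i] continuous_on_eq_continuous_at[of UNIV] by blast
  have la: "(\<lambda>n. \<psi> i (x (s n))) \<longlonglongrightarrow> \<psi> i a" for i
    using coord[OF LIMSEQ_subseq_LIMSEQ[OF lima q], of i] by (simp add: s_def \<Psi>_def comp_def)
  have lb: "(\<lambda>n. \<psi> i (y (s n))) \<longlonglongrightarrow> \<psi> i b" for i
    using coord[OF limb, of i] by (simp add: s_def \<Psi>_def comp_def)
  have "\<phi> i a = \<phi> i b" for i
  proof -
    \<comment> \<open>For fixed \<open>i\<close> the bound \<open>inverse (Suc n)\<close> is
      available as soon as \<open>n\<close> is at least \<open>i\<close>.\<close>
    have "(\<lambda>n. \<phi> i (x n) - \<phi> i (y n)) \<longlonglongrightarrow> 0"
    proof (rule Lim_null_comparison[OF _ LIMSEQ_inverse_real_of_nat])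
      show "\<forall>\<^sub>F n in sequentially. norm (\<phi> i (x n) - \<phi> i (y n)) \<le> inverse (real (Suc n))"
        unfolding eventually_sequentially using close by (metis less_imp_le le_imp_less_Suc real_norm_def)
    qed
    then have "(\<lambda>n. \<phi> i (x (s n)) - \<phi> i (y (s n))) \<longlonglongrightarrow> 0"
      using LIMSEQ_subseq_LIMSEQ[OF _ s] by (fastforce simp: comp_def)
    moreover have "(\<lambda>n. \<phi> i (x (s n)) - \<phi> i (y (s n))) \<longlonglongrightarrow> \<phi> i a - \<phi> i b"
      using tendsto_diff[OF la[of "Suc i"] lb[of "Suc i"]] by (simp add: \<psi>_def)
    ultimately show ?thesis using LIMSEQ_unique by fastforce
  qed
  then have "g a = g b" using determined a b by blast
  moreover have "(\<lambda>n. \<bar>g (x (s n)) - g (y (s n))\<bar>) \<longlonglongrightarrow> \<bar>g a - g b\<bar>"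
    using tendsto_rabs[OF tendsto_diff[OF la[of 0] lb[of 0]]] by (simp add: \<psi>_def)
  then have "\<epsilon> \<le> \<bar>g a - g b\<bar>"
    by (rule LIMSEQ_le_const) (use far in blast)
  ultimately show False using \<open>\<epsilon> > 0\<close> by simp
qed

section \<open>Cluster functions of sequences\<close>

text \<open>The closures of the tails are nested nonempty closed sets in a compact set;
  \<open>g\<close> is a common point. One \<open>k\<close> serves two points at once, so that an
  equality between the values at \<open>y\<close> and \<open>z\<close>, valid along the whole
  sequence, passes to \<open>g\<close>.\<close>

lemma grothendieck_pair_cluster:
  fixes \<Phi> :: "'a \<Rightarrow> 'b \<Rightarrow> real"
  assumes G: "grothendieck_pair X Y"
    and Y: "\<And>x. x \<in> topspace X \<Longrightarrow> continuous_map Y euclideanreal (\<Phi> x)"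
    and X: "\<And>y. y \<in> topspace Y \<Longrightarrow> continuous_map X euclideanreal (\<lambda>x. \<Phi> x y)"
    and x: "\<And>n::nat. x n \<in> topspace X"
  shows "\<exists>g. continuous_map Y euclideanreal g \<and>
    (\<forall>N \<delta>. \<forall>y\<in>topspace Y. \<forall>z\<in>topspace Y. \<delta> > 0 \<longrightarrow>
      (\<exists>k\<ge>N. \<bar>\<Phi> (x k) y - g y\<bar> < \<delta> \<and> \<bar>\<Phi> (x k) z - g z\<bar> < \<delta>))"
proof -
  define F where "F = (\<lambda>x. restrict (\<Phi> x) (topspace Y))"
  have F: "continuous_map X (Cp Y) F"
    unfolding F_def by (rule continuous_map_into_Cp[OF Y X])
  define K where "K = Cp Y closure_of (F ` topspace X)"
  have K: "compactin (Cp Y) K"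
    using G F unfolding grothendieck_pair_def K_def by blast
  define C where "C = (\<lambda>n. Cp Y closure_of ((\<lambda>k. F (x k)) ` {n..}))"
  have FX: "F ` topspace X \<subseteq> topspace (Cp Y)"
    by (rule continuous_map_image_subset_topspace[OF F])
  have CK: "C n \<subseteq> K" for n
    unfolding C_def K_def by (rule closure_of_mono) (use x in auto)
  have "(\<Inter>n. C n) \<noteq> {}"
  proof (rule compact_space_imp_nest)
    show "compact_space (subtopology (Cp Y) K)"
      using K by (rule compact_space_subtopology)
    show "closedin (subtopology (Cp Y) K) (C n)" for n
      using CK[of n] by (intro closedin_subset_topspace) (auto simp: C_def)
    show "C n \<noteq> {}" for n
    proof -
      have "(\<lambda>k. F (x k)) ` {n..} \<subseteq> C n"
        unfolding C_def by (rule closure_of_subset) (use FX x in blast)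
      then show ?thesis by auto
    qed
    show "decseq C"
      unfolding decseq_def C_def by (intro allI impI closure_of_mono) auto
  qed
  then obtain g where g: "\<And>n. g \<in> C n" by blast
  show ?thesis
  proof (intro exI[of _ g] conjI allI ballI impI)
    have "g \<in> topspace (Cp Y)" using g[of 0] in_closure_of unfolding C_def by metis
    then show "continuous_map Y euclideanreal g" by (simp add: topspace_Cp)
  next
    fix N \<delta> y z assume d: "(\<delta>::real) > 0" and y: "y \<in> topspace Y" and z: "z \<in> topspace Y"
    define U where "U = (\<lambda>w. {h \<in> topspace (Cp Y). h w \<in> ball (g w) \<delta>})"
    have U: "openin (Cp Y) (U w)" if "w \<in> topspace Y" for w
      unfolding U_def
      by (rule openin_continuous_map_preimage[OF continuous_map_Cp_eval[OF that]]) simp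
    have "g \<in> topspace (Cp Y)" using g[of 0] in_closure_of unfolding C_def by metis
    then have "openin (Cp Y) (U y \<inter> U z)" "g \<in> U y \<inter> U z"
      using U y z d by (auto simp: U_def)
    moreover have "\<forall>T. g \<in> T \<and> openin (Cp Y) T \<longrightarrow> (\<exists>h\<in>(\<lambda>k. F (x k)) ` {N..}. h \<in> T)"
      using g[of N] by (simp add: C_def in_closure_of)
    ultimately have "\<exists>h\<in>(\<lambda>k. F (x k)) ` {N..}. h \<in> U y \<inter> U z"
      by blast
    then obtain k where "k \<ge> N" "F (x k) \<in> U y \<inter> U z"
      by auto
    then show "\<exists>k\<ge>N. \<bar>\<Phi> (x k) y - g y\<bar> < \<delta> \<and> \<bar>\<Phi> (x k) z - g z\<bar> < \<delta>"
      using y z by (auto simp: U_def F_def dist_real_def abs_minus_commute)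
  qed
qed

section \<open>Counting uniformly separated functions\<close>

lemma floor_scaled_eq_imp_close:
  fixes u v \<epsilon> :: real
  assumes "\<lfloor>u / \<epsilon>\<rfloor> = \<lfloor>v / \<epsilon>\<rfloor>" and "\<epsilon> > 0"
  shows "\<bar>u - v\<bar> < \<epsilon>"
proof -
  have "\<bar>u / \<epsilon> - v / \<epsilon>\<bar> < 1" using assms(1) by linarith
  then show ?thesis using assms(2) by (simp add: field_simps flip: diff_divide_distrib)
qed

text \<open>A function with modulus \<open>n\<close> is recovered up to \<open>2\<epsilon>\<close> from the finite set of all joint
  quantised values of \<open>(\<phi> 0, \<dots>, \<phi> n, g)\<close>, and there are only countably many such sets.\<close>

lemma pseudocompact_space_countable_net:
  fixes \<phi> :: "nat \<Rightarrow> 'a \<Rightarrow> real" and g :: "'i \<Rightarrow> 'a \<Rightarrow> real"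
  assumes X: "pseudocompact_space X"
    and \<phi>: "\<And>i. continuous_map X euclideanreal (\<phi> i)"
    and g: "\<And>\<alpha>. continuous_map X euclideanreal (g \<alpha>)"
    and determined: "\<And>\<alpha> x y. \<lbrakk>x \<in> topspace X; y \<in> topspace X; \<And>i. \<phi> i x = \<phi> i y\<rbrakk> \<Longrightarrow> g \<alpha> x = g \<alpha> y"
    and "\<epsilon> > 0"
    and separated: "\<And>\<alpha> \<beta>. \<alpha> \<noteq> \<beta> \<Longrightarrow> \<exists>x\<in>topspace X. 2 * \<epsilon> \<le> \<bar>g \<alpha> x - g \<beta> x\<bar>"
  shows "countable (UNIV :: 'i set)"
proof -
  have "\<exists>n. \<forall>x y. x \<in> topspace X \<longrightarrow> y \<in> topspace X \<longrightarrow>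
      (\<forall>i<Suc n. \<bar>\<phi> i x - \<phi> i y\<bar> < inverse (Suc n)) \<longrightarrow> \<bar>g \<alpha> x - g \<alpha> y\<bar> < \<epsilon>" for \<alpha>
    by (rule pseudocompact_space_uniform_modulus[where X = X and \<phi> = \<phi> and g = "g \<alpha>" and \<epsilon> = \<epsilon>])
      (use X \<phi> g determined \<open>\<epsilon> > 0\<close> in blast)+
  then obtain n where n: "\<And>\<alpha> x y. \<lbrakk>x \<in> topspace X; y \<in> topspace X;
      \<And>i. i < Suc (n \<alpha>) \<Longrightarrow> \<bar>\<phi> i x - \<phi> i y\<bar> < inverse (Suc (n \<alpha>))\<rbrakk> \<Longrightarrow> \<bar>g \<alpha> x - g \<alpha> y\<bar> < \<epsilon>"
    by metis
  \<comment> \<open>The mesh equals the tolerance in the modulus, so points with equal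
    \<open>Q\<close> satisfy its hypothesis.\<close>
  define Q where "Q = (\<lambda>n x. map (\<lambda>i. \<lfloor>\<phi> i x / inverse (Suc n)\<rfloor>) [0..<Suc n])"
  \<comment> \<open>The code records \<open>n \<alpha>\<close> too, so that functions with equal
    codes were quantised on the same grid.\<close>
  define code where
    "code = (\<lambda>\<alpha>. (n \<alpha>, (\<lambda>x. (Q (n \<alpha>) x, \<lfloor>g \<alpha> x / \<epsilon>\<rfloor>)) ` topspace X))"
  have fin1: "finite ((\<lambda>x. \<lfloor>h x / d\<rfloor>) ` topspace X)"
    if h: "continuous_map X euclideanreal h" and "d > 0" for h and d :: real
  proof -
    obtain M where M: "\<And>x. x \<in> topspace X \<Longrightarrow> \<bar>h x\<bar> \<le> M"
      using X h by (force simp: pseudocompact_space_def bounded_iff)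
    have "(\<lambda>x. \<lfloor>h x / d\<rfloor>) ` topspace X \<subseteq> {\<lfloor>- M / d\<rfloor>..\<lfloor>M / d\<rfloor>}"
    proof clarsimp
      fix x assume "x \<in> topspace X"
      then have "- M \<le> h x" "h x \<le> M" using M[of x] by linarith+
      then have "- M / d \<le> h x / d" "h x / d \<le> M / d"
        using \<open>d > 0\<close> by (intro divide_right_mono; simp)+
      then show "\<lfloor>- (M / d)\<rfloor> \<le> \<lfloor>h x / d\<rfloor> \<and> \<lfloor>h x / d\<rfloor> \<le> \<lfloor>M / d\<rfloor>"
        using floor_mono by auto
    qed
    then show ?thesis using finite_subset by blast
  qed
  \<comment> \<open>Finiteness is essential for counting: a countable type has only countably many
    finite subsets, but may have uncountably many subsets.\<close>
  have fin: "finite (snd (code \<alpha>))" for \<alpha>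
  proof -
    define E where "E = (\<Union>i<Suc (n \<alpha>). (\<lambda>x. \<lfloor>\<phi> i x / inverse (Suc (n \<alpha>))\<rfloor>) ` topspace X)"
    have "finite E" unfolding E_def using fin1[OF \<phi>] by auto
    then have "finite ({l. set l \<subseteq> E \<and> length l = Suc (n \<alpha>)} \<times> (\<lambda>x. \<lfloor>g \<alpha> x / \<epsilon>\<rfloor>) ` topspace X)"
      using fin1[OF g \<open>\<epsilon> > 0\<close>] by (intro finite_cartesian_product finite_lists_length_eq)
    moreover have "snd (code \<alpha>) \<subseteq>
        {l. set l \<subseteq> E \<and> length l = Suc (n \<alpha>)} \<times> (\<lambda>x. \<lfloor>g \<alpha> x / \<epsilon>\<rfloor>) ` topspace X"
      by (force simp: code_def Q_def E_def)
    ultimately show ?thesis by (rule finite_subset[rotated])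
  qed
  have "inj code"
  proof (rule injI, rule ccontr)
    fix \<alpha> \<beta> assume eq: "code \<alpha> = code \<beta>" and "\<alpha> \<noteq> \<beta>"
    then obtain x where x: "x \<in> topspace X" and far: "2 * \<epsilon> \<le> \<bar>g \<alpha> x - g \<beta> x\<bar>"
      using separated by blast
    have neq: "n \<alpha> = n \<beta>" using eq by (simp add: code_def)
    \<comment> \<open>Equal codes give a point \<open>y\<close> on which \<open>g \<beta>\<close>
      has the quantised value that \<open>g \<alpha>\<close> has at \<open>x\<close>. Thus
      \<open>g \<beta> y\<close> is within \<open>\<epsilon>\<close> of \<open>g \<alpha> x\<close>
      by quantisation and of \<open>g \<beta> x\<close> by the modulus, against the gap
      \<open>2 * \<epsilon>\<close>.\<close>
    have "(Q (n \<alpha>) x, \<lfloor>g \<alpha> x / \<epsilon>\<rfloor>) \<in> snd (code \<beta>)"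
      unfolding eq[symmetric] using x by (simp add: code_def)
    then obtain y where y: "y \<in> topspace X" and Q: "Q (n \<alpha>) x = Q (n \<alpha>) y"
      and fl: "\<lfloor>g \<alpha> x / \<epsilon>\<rfloor> = \<lfloor>g \<beta> y / \<epsilon>\<rfloor>"
      using neq by (auto simp: code_def)
    have "\<bar>\<phi> i x - \<phi> i y\<bar> < inverse (Suc (n \<beta>))" if "i < Suc (n \<beta>)" for i
    proof (rule floor_scaled_eq_imp_close)
      show "\<lfloor>\<phi> i x / inverse (real (Suc (n \<beta>)))\<rfloor> = \<lfloor>\<phi> i y / inverse (real (Suc (n \<beta>)))\<rfloor>"
        using Q[unfolded Q_def neq map_eq_conv, rule_format, of i] that
        by (auto simp: less_Suc_eq)
    qed simp
    then have "\<bar>g \<beta> x - g \<beta> y\<bar> < \<epsilon>" using n x y by blast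
    moreover have "\<bar>g \<alpha> x - g \<beta> y\<bar> < \<epsilon>"
      by (rule floor_scaled_eq_imp_close[OF fl \<open>\<epsilon> > 0\<close>])
    ultimately show False using far by linarith
  qed
  moreover have "range code \<subseteq> UNIV \<times> Collect finite"
  proof (rule image_subsetI)
    show "code \<alpha> \<in> UNIV \<times> Collect finite" for \<alpha>
      unfolding mem_Times_iff using fin by simp
  qed
  then have "countable (range code)"
    by (rule countable_subset) (intro countable_SIGMA countable_Collect_finite countableI_type)
  ultimately show ?thesis using countable_image_inj_on by blast
qed

section \<open>The Cantor scheme\<close>

lemma uncountable_nat_bool: "uncountable (UNIV :: (nat \<Rightarrow> bool) set)"
proof
  assume "countable (UNIV :: (nat \<Rightarrow> bool) set)"
  then obtain h :: "nat \<Rightarrow> nat \<Rightarrow> bool" where "range h = UNIV"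
    using uncountable_def by blast
  then obtain k where "h k = (\<lambda>i. \<not> h i i)" by (metis UNIV_I rangeE)
  then show False by metis
qed

text \<open>If every relatively open piece of \<open>A\<close> oscillates by more than
  \<open>\<epsilon>\<close>, pieces can be split forever into pairs separated at a point of
  \<open>Y\<close>. Each branch of this binary tree has a cluster function, and these functions are
  too many for \<open>pseudocompact_space_countable_net\<close>.\<close>

lemma grothendieck_pair_small_oscillation:
  fixes \<Phi> :: "'a \<Rightarrow> 'b \<Rightarrow> real"
  assumes G: "grothendieck_pair X Y" and psY: "pseudocompact_space Y"
    and Y: "\<And>x. x \<in> topspace X \<Longrightarrow> continuous_map Y euclideanreal (\<Phi> x)"
    and X: "\<And>y. y \<in> topspace Y \<Longrightarrow> continuous_map X euclideanreal (\<lambda>x. \<Phi> x y)"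
    and A: "A \<subseteq> topspace X" "A \<noteq> {}" and "\<epsilon> > 0"
  obtains (small) U where "openin X U" "U \<inter> A \<noteq> {}"
    "\<And>x z y. \<lbrakk>x \<in> U \<inter> A; z \<in> U \<inter> A; y \<in> topspace Y\<rbrakk> \<Longrightarrow> \<bar>\<Phi> x y - \<Phi> z y\<bar> \<le> \<epsilon>"
proof (rule ccontr)
  assume "\<not> thesis"
  then have large: "\<exists>p q y. p \<in> U \<inter> A \<and> q \<in> U \<inter> A \<and> y \<in> topspace Y \<and> \<epsilon> < \<bar>\<Phi> p y - \<Phi> q y\<bar>"
    if "openin X U" "U \<inter> A \<noteq> {}" for U
    using small[of U] that by (meson not_le)
  define good where "good = (\<lambda>U. openin X U \<and> U \<inter> A \<noteq> {})"
  \<comment> \<open>The premise \<open>good U\<close> stands below the existential quantifiers so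
    that choice yields total functions \<open>V\<close>, \<open>W\<close>, \<open>b\<close>.\<close>
  have split: "\<exists>V W y. good U \<longrightarrow> good V \<and> good W \<and> V \<subseteq> U \<and> W \<subseteq> U \<and> y \<in> topspace Y \<and>
      (\<forall>x\<in>V. \<forall>z\<in>W. \<epsilon> \<le> \<bar>\<Phi> x y - \<Phi> z y\<bar>)" for U
  proof (cases "good U")
    case True
    then obtain p q y where p: "p \<in> U \<inter> A" and q: "q \<in> U \<inter> A" and y: "y \<in> topspace Y"
      and far: "\<epsilon> < \<bar>\<Phi> p y - \<Phi> q y\<bar>"
      using large unfolding good_def by blast
    \<comment> \<open>Half of the excess over \<open>\<epsilon>\<close>: moving both values by less
      than \<open>\<eta>\<close> keeps them at least \<open>\<epsilon>\<close> apart.\<close>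
    define \<eta> where "\<eta> = (\<bar>\<Phi> p y - \<Phi> q y\<bar> - \<epsilon>) / 2"
    define N where "N = (\<lambda>p. U \<inter> {x \<in> topspace X. \<Phi> x y \<in> ball (\<Phi> p y) \<eta>})"
    have N: "good (N a)" if "a \<in> U \<inter> A" for a
      unfolding good_def
    proof
      show "openin X (N a)"
        unfolding N_def using True openin_continuous_map_preimage[OF X[OF y]]
        by (intro openin_Int) (simp_all add: good_def del: mem_ball)
      have "a \<in> N a \<inter> A" using that A far by (auto simp: N_def \<eta>_def)
      then show "N a \<inter> A \<noteq> {}" by blast
    qed
    have "\<epsilon> \<le> \<bar>\<Phi> x y - \<Phi> z y\<bar>" if "x \<in> N p" "z \<in> N q" for x z
    proof -
      have "\<bar>\<Phi> p y - \<Phi> x y\<bar> < \<eta>" "\<bar>\<Phi> q y - \<Phi> z y\<bar> < \<eta>"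
        using that by (auto simp: N_def dist_real_def)
      moreover have "\<bar>\<Phi> p y - \<Phi> q y\<bar> = \<epsilon> + 2 * \<eta>" by (simp add: \<eta>_def field_simps)
      ultimately show ?thesis by linarith
    qed
    then show ?thesis using N p q y by (intro exI[of _ "N p"] exI[of _ "N q"] exI[of _ y]) (auto simp: N_def)
  qed blast
  then obtain V W b where all: "\<And>U. good U \<longrightarrow> good (V U) \<and> good (W U) \<and> V U \<subseteq> U \<and> W U \<subseteq> U \<and>
      b U \<in> topspace Y \<and> (\<forall>x\<in>V U. \<forall>z\<in>W U. \<epsilon> \<le> \<bar>\<Phi> x (b U) - \<Phi> z (b U)\<bar>)"
    by metis
  from all have VW: "\<And>U. good U \<Longrightarrow> good (V U)" "\<And>U. good U \<Longrightarrow> good (W U)"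
      "\<And>U. good U \<Longrightarrow> V U \<subseteq> U" "\<And>U. good U \<Longrightarrow> W U \<subseteq> U" "\<And>U. good U \<Longrightarrow> b U \<in> topspace Y"
    and sep: "\<And>U x z. \<lbrakk>good U; x \<in> V U; z \<in> W U\<rbrakk> \<Longrightarrow> \<epsilon> \<le> \<bar>\<Phi> x (b U) - \<Phi> z (b U)\<bar>"
    by simp_all
  \<comment> \<open>The tree of good sets. Since \<open>foldr\<close> handles the head last, the
    head of the list is the most recent choice.\<close>
  define T :: "bool list \<Rightarrow> 'a set" where
    "T = (\<lambda>s. foldr (\<lambda>c U. if c then V U else W U) s (topspace X))"
  have T_Cons: "T (c # s) = (if c then V (T s) else W (T s))" for c s
    by (simp add: T_def)
  have T: "good (T s)" for s
  proof (induction s)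
    case Nil show ?case using A by (auto simp: T_def good_def)
  qed (use VW(1,2) in \<open>simp add: T_Cons\<close>)
  have "\<exists>x. x \<in> T s \<inter> A" for s using T[of s] by (auto simp: good_def)
  then obtain x where x: "\<And>s. x s \<in> T s" and xA: "\<And>s. x s \<in> A" by (metis IntE)
  \<comment> \<open>The first \<open>n\<close> bits of \<open>\<alpha>\<close>, newest first, to
    match the order in \<open>T\<close>.\<close>
  define br :: "(nat \<Rightarrow> bool) \<Rightarrow> nat \<Rightarrow> bool list" where "br = (\<lambda>\<alpha> n. rev (map \<alpha> [0..<n]))"
  have br_Suc: "br \<alpha> (Suc n) = \<alpha> n # br \<alpha> n" for \<alpha> n
    by (simp add: br_def)
  have dec: "decseq (\<lambda>n. T (br \<alpha> n))" for \<alpha>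
  proof (rule decseq_SucI)
    show "T (br \<alpha> (Suc n)) \<subseteq> T (br \<alpha> n)" for n
      using VW(3,4)[OF T[of "br \<alpha> n"]] by (simp add: br_Suc T_Cons)
  qed
  have xT: "x (br \<alpha> k) \<in> T (br \<alpha> n)" if "k \<ge> n" for \<alpha> k n
    using decseqD[OF dec that] x by blast
  have "\<forall>\<alpha>. \<exists>g. continuous_map Y euclideanreal g \<and>
      (\<forall>N \<delta>. \<forall>y\<in>topspace Y. \<forall>z\<in>topspace Y. \<delta> > 0 \<longrightarrow>
        (\<exists>k\<ge>N. \<bar>\<Phi> (x (br \<alpha> k)) y - g y\<bar> < \<delta> \<and> \<bar>\<Phi> (x (br \<alpha> k)) z - g z\<bar> < \<delta>))"
  proof
    have "x s \<in> topspace X" for s using xA A by blast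
    then show "\<exists>g. continuous_map Y euclideanreal g \<and>
      (\<forall>N \<delta>. \<forall>y\<in>topspace Y. \<forall>z\<in>topspace Y. \<delta> > 0 \<longrightarrow>
        (\<exists>k\<ge>N. \<bar>\<Phi> (x (br \<alpha> k)) y - g y\<bar> < \<delta> \<and> \<bar>\<Phi> (x (br \<alpha> k)) z - g z\<bar> < \<delta>))" for \<alpha>
      by (intro grothendieck_pair_cluster[OF G, of \<Phi> "\<lambda>k. x (br \<alpha> k)"] Y X)
  qed
  from choice[OF this] obtain g where g: "\<And>\<alpha>. continuous_map Y euclideanreal (g \<alpha>)"
    and cl: "\<And>\<alpha> N \<delta> y z. \<lbrakk>\<delta> > 0; y \<in> topspace Y; z \<in> topspace Y\<rbrakk> \<Longrightarrow>
        \<exists>k\<ge>N. \<bar>\<Phi> (x (br \<alpha> k)) y - g \<alpha> y\<bar> < \<delta> \<and> \<bar>\<Phi> (x (br \<alpha> k)) z - g \<alpha> z\<bar> < \<delta>"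
    by blast
  have separated: "\<exists>y\<in>topspace Y. \<epsilon> / 2 \<le> \<bar>g \<alpha> y - g \<beta> y\<bar>" if "\<alpha> m" "\<not> \<beta> m" "br \<alpha> m = br \<beta> m" for \<alpha> \<beta> m
  proof -
    \<comment> \<open>The witness is the separating point of the node where the branches part. From
      index \<open>Suc m\<close> on, one sequence stays in the \<open>V\<close> half and the other
      in the \<open>W\<close> half; two approximations by \<open>\<epsilon> / 4\<close> reduce the
      gap to \<open>\<epsilon> / 2\<close>.\<close>
    let ?y = "b (T (br \<alpha> m))"
    have y: "?y \<in> topspace Y" using VW(5) T by blast
    obtain k where k: "k \<ge> Suc m" "\<bar>\<Phi> (x (br \<alpha> k)) ?y - g \<alpha> ?y\<bar> < \<epsilon> / 4"
      using cl[of "\<epsilon> / 4" ?y ?y "Suc m" \<alpha>] y \<open>\<epsilon> > 0\<close> by auto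
    obtain l where l: "l \<ge> Suc m" "\<bar>\<Phi> (x (br \<beta> l)) ?y - g \<beta> ?y\<bar> < \<epsilon> / 4"
      using cl[of "\<epsilon> / 4" ?y ?y "Suc m" \<beta>] y \<open>\<epsilon> > 0\<close> by auto
    have "x (br \<alpha> k) \<in> V (T (br \<alpha> m))" "x (br \<beta> l) \<in> W (T (br \<alpha> m))"
      using xT[OF k(1), of \<alpha>] xT[OF l(1), of \<beta>] that by (simp_all add: br_Suc T_Cons)
    then have "\<epsilon> \<le> \<bar>\<Phi> (x (br \<alpha> k)) ?y - \<Phi> (x (br \<beta> l)) ?y\<bar>" using sep T by blast
    then have "\<epsilon> / 2 \<le> \<bar>g \<alpha> ?y - g \<beta> ?y\<bar>" using k(2) l(2) by linarith
    then show ?thesis using y by blast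
  qed
  have "countable (UNIV :: (nat \<Rightarrow> bool) set)"
  \<comment> \<open>There are countably many nodes, so \<open>from_nat\<close> enumerates all
    functions \<open>\<Phi> (x s)\<close> as one sequence. The value \<open>\<epsilon> / 4\<close>
    matches the required gap \<open>2 * (\<epsilon> / 4)\<close> with
    \<open>\<epsilon> / 2\<close>.\<close>
  proof (rule pseudocompact_space_countable_net[OF psY, where g = g and \<epsilon> = "\<epsilon> / 4"
        and \<phi> = "\<lambda>i. \<Phi> (x (from_nat i))"])
    show "continuous_map Y euclideanreal (\<Phi> (x (from_nat i)))" for i
      using Y xA A by blast
    show "g \<alpha> u = g \<alpha> v" if uv: "u \<in> topspace Y" "v \<in> topspace Y"
      and eq: "\<And>i. \<Phi> (x (from_nat i)) u = \<Phi> (x (from_nat i)) v" for \<alpha> u v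
    proof (rule ccontr)
      assume "g \<alpha> u \<noteq> g \<alpha> v"
      \<comment> \<open>A single \<open>k\<close> approximates at both \<open>u\<close> and
        \<open>v\<close>. As \<open>\<Phi> (x (br \<alpha> k))\<close> takes equal values there, the
        gap of \<open>g \<alpha>\<close> would be smaller than itself.\<close>
      then obtain k where k: "\<bar>\<Phi> (x (br \<alpha> k)) u - g \<alpha> u\<bar> < \<bar>g \<alpha> u - g \<alpha> v\<bar> / 2"
          "\<bar>\<Phi> (x (br \<alpha> k)) v - g \<alpha> v\<bar> < \<bar>g \<alpha> u - g \<alpha> v\<bar> / 2"
        using cl[of "\<bar>g \<alpha> u - g \<alpha> v\<bar> / 2" u v 0 \<alpha>] uv by auto
      have "\<Phi> (x (br \<alpha> k)) u = \<Phi> (x (br \<alpha> k)) v"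
        using eq[of "to_nat (br \<alpha> k)"] by simp
      then have "\<bar>g \<alpha> u - g \<alpha> v\<bar> \<le> \<bar>\<Phi> (x (br \<alpha> k)) u - g \<alpha> u\<bar> + \<bar>\<Phi> (x (br \<alpha> k)) v - g \<alpha> v\<bar>"
        using abs_triangle_ineq4[of "\<Phi> (x (br \<alpha> k)) v - g \<alpha> v" "\<Phi> (x (br \<alpha> k)) u - g \<alpha> u"] by simp
      then show False using add_strict_mono[OF k] by simp
    qed
    show "\<exists>y\<in>topspace Y. 2 * (\<epsilon> / 4) \<le> \<bar>g \<alpha> y - g \<beta> y\<bar>" if "\<alpha> \<noteq> \<beta>" for \<alpha> \<beta>
    proof -
      define m where "m = (LEAST m. \<alpha> m \<noteq> \<beta> m)"
      from that obtain i where "\<alpha> i \<noteq> \<beta> i" by blast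
      then have m: "\<alpha> m \<noteq> \<beta> m" unfolding m_def by (rule LeastI)
      have "\<alpha> i = \<beta> i" if "i < m" for i
        using not_less_Least[of i "\<lambda>m. \<alpha> m \<noteq> \<beta> m"] that by (simp add: m_def)
      then have "map \<alpha> [0..<m] = map \<beta> [0..<m]" by simp
      then have br: "br \<alpha> m = br \<beta> m" by (simp only: br_def)
      show ?thesis
      proof (cases "\<alpha> m")
        case True
        then show ?thesis using separated[of \<alpha> m \<beta>] m br by simp
      next
        case False
        then show ?thesis using separated[of \<beta> m \<alpha>] m br by (simp add: abs_minus_commute)
      qed
    qed
    show "continuous_map Y euclideanreal (g \<alpha>)" for \<alpha> by (rule g)
    show "\<epsilon> / 4 > 0" using \<open>\<epsilon> > 0\<close> by simp
  qed
  then show False using uncountable_nat_bool by blast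
qed

section \<open>Continuity of the group operations\<close>

theorem corollary5p1:
  fixes S :: "('a, 'm) monoid_scheme" and X :: "'a topology" and G :: "'a set" and e :: 'a
  assumes "semitopological_monoid S X"
    and "tychonoff_space X"
    and "grothendieck_pair X X"
    and "semigroup_subgroup G e S"
  shows "topological_group (S\<lparr>carrier := G, one := e\<rparr>) (subtopology X G)"
proof -
  interpret S: semitopological_monoid S X by fact
  let ?G = "S\<lparr>carrier := G, one := e\<rparr>"
  interpret G: group ?G using assms(4) by (simp add: semigroup_subgroup_def)
  have GS: "G \<subseteq> topspace X"
    using assms(4) by (simp add: semigroup_subgroup_def S.topspace_eq)
  have ps: "pseudocompact_space X"
    using assms(3) GS G.one_closed by (intro grothendieck_pair_imp_pseudocompact) auto
  let ?m = "\<lambda>x y. x \<otimes>\<^bsub>S\<^esub> y"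
  define i where "i = (\<lambda>x. inv\<^bsub>?G\<^esub> x)"
  have e: "e \<in> G" using G.one_closed by simp
  have closed: "?m x y \<in> G" if "x \<in> G" "y \<in> G" for x y using G.m_closed that by simp
  have assoc: "?m (?m x y) z = ?m x (?m y z)" if "x \<in> G" "y \<in> G" "z \<in> G" for x y z
    using G.m_assoc that by simp
  have unit: "?m e x = x" "?m x e = x" if "x \<in> G" for x using G.l_one G.r_one that by simp_all
  have inv: "i x \<in> G" "?m (i x) x = e" "?m x (i x) = e" if "x \<in> G" for x
    using G.inv_closed G.l_inv G.r_inv that by (simp_all add: i_def)
  have lc: "continuous_map X X (?m a)" and rc: "continuous_map X X (\<lambda>x. ?m x a)" if "a \<in> G" for a
    using that GS S.continuous_left_mult S.continuous_right_mult S.topspace_eq by auto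

  \<comment> \<open>Left translation by \<open>v\<close> near \<open>e\<close> changes
    \<open>f\<close> little, uniformly on \<open>G\<close>. This uniformity replaces joint
    continuity.\<close>
  have small: "\<exists>V. openin X V \<and> e \<in> V \<and> (\<forall>v\<in>V \<inter> G. \<forall>y\<in>G. \<bar>f (?m v y) - f y\<bar> \<le> 1/3)"
    if f: "continuous_map X euclideanreal f" for f
  proof -
    obtain U where U: "openin X U" "U \<inter> G \<noteq> {}" and osc:
      "\<And>x z y. \<lbrakk>x \<in> U \<inter> G; z \<in> U \<inter> G; y \<in> topspace X\<rbrakk> \<Longrightarrow> \<bar>f (?m x y) - f (?m z y)\<bar> \<le> 1/3"
    proof (rule grothendieck_pair_small_oscillation[OF assms(3) ps, where \<Phi> = "\<lambda>x y. f (?m x y)"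
          and A = G and \<epsilon> = "1/3"])
      show "continuous_map X euclideanreal (\<lambda>y. f (?m x y))" if "x \<in> topspace X" for x
        using continuous_map_compose[OF S.continuous_left_mult f] that
        by (simp add: comp_def S.topspace_eq)
      show "continuous_map X euclideanreal (\<lambda>x. f (?m x y))" if "y \<in> topspace X" for y
        using continuous_map_compose[OF S.continuous_right_mult f] that
        by (simp add: comp_def S.topspace_eq)
    qed (use GS e in auto)
    then obtain h where h: "h \<in> U" "h \<in> G" by blast
    \<comment> \<open>Right translation by \<open>h\<close> carries \<open>e\<close> to
      \<open>h\<close>, so \<open>V\<close> is a neighbourhood of \<open>e\<close>. Only separate
      continuity is involved.\<close>
    define V where "V = {v \<in> topspace X. ?m v h \<in> U}"
    have "openin X V"
      unfolding V_def by (rule openin_continuous_map_preimage[OF rc[OF h(2)] U(1)])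
    moreover have "e \<in> V" using h e GS unit by (auto simp: V_def)
    moreover have "\<bar>f (?m v y) - f y\<bar> \<le> 1/3" if "v \<in> V \<inter> G" "y \<in> G" for v y
    proof -
      \<comment> \<open>Multiplying \<open>?m v h\<close> and \<open>h\<close> on the right by
        \<open>?z\<close> gives \<open>?m v y\<close> and \<open>y\<close>, so the oscillation bound
        on \<open>U\<close> becomes the one wanted at \<open>e\<close>.\<close>
      let ?z = "?m (i h) y"
      have "?m (?m v h) ?z = ?m v y" "?m h ?z = y"
        using that h inv closed unit by (simp_all add: assoc flip: assoc[of h "i h"])
      moreover have "\<bar>f (?m (?m v h) ?z) - f (?m h ?z)\<bar> \<le> 1/3"
        using that h inv closed GS by (intro osc) (auto simp: V_def)
      ultimately show ?thesis by simp
    qed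
    ultimately show ?thesis by blast
  qed

  \<comment> \<open>Complete regularity reduces membership in \<open>W\<close> to the inequality
    \<open>f x < 1\<close>, which leaves room for two errors of \<open>1/3\<close>.\<close>
  have sep: "\<exists>f. continuous_map X euclideanreal f \<and> f p = 0 \<and> (\<forall>x\<in>topspace X. f x < 1 \<longrightarrow> x \<in> W)"
    if "openin X W" "p \<in> W" for W p
  proof -
    have "closedin X (topspace X - W)" "p \<in> topspace X - (topspace X - W)"
      using that openin_subset by blast+
    then obtain f :: "'a \<Rightarrow> real" where f: "continuous_map X (top_of_set {0..1}) f" "f p = 0"
        "f ` (topspace X - W) \<subseteq> {1}"
      using assms(2) unfolding tychonoff_space_def completely_regular_space_def by metis
    then show ?thesis
      by (intro exI[of _ f]) (force simp: continuous_map_in_subtopology)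
  qed

  have topG: "topspace (subtopology X G) = G" using GS by auto
  have mult: "continuous_map (prod_topology (subtopology X G) (subtopology X G)) (subtopology X G)
      (\<lambda>(x, y). ?m x y)"
    unfolding continuous_map_eq_topcontinuous_at topcontinuous_at_def
  proof (intro ballI conjI allI impI)
    fix p assume "p \<in> topspace (prod_topology (subtopology X G) (subtopology X G))"
    then obtain a b where p: "p = (a, b)" and a: "a \<in> G" and b: "b \<in> G" using topG by auto
    show "p \<in> topspace (prod_topology (subtopology X G) (subtopology X G))" by fact
    show "(\<lambda>(x, y). ?m x y) \<in> topspace (prod_topology (subtopology X G) (subtopology X G))
        \<rightarrow> topspace (subtopology X G)"
      using closed topG by auto
    fix W' assume "openin (subtopology X G) W' \<and> (case p of (x, y) \<Rightarrow> ?m x y) \<in> W'"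
    then obtain W where W: "openin X W" "W' = W \<inter> G" "?m a b \<in> W"
      by (auto simp: p openin_subtopology)
    obtain f where f: "continuous_map X euclideanreal f" "f (?m a b) = 0"
      and fW: "\<And>x. x \<in> topspace X \<Longrightarrow> f x < 1 \<Longrightarrow> x \<in> W"
      using sep[OF W(1,3)] by blast
    obtain V where V: "openin X V" "e \<in> V"
      and osc: "\<And>v y. v \<in> V \<inter> G \<Longrightarrow> y \<in> G \<Longrightarrow> \<bar>f (?m v y) - f y\<bar> \<le> 1/3"
      using small[OF f(1)] by blast
    \<comment> \<open>The product \<open>x y\<close> is rewritten as \<open>(x (i a)) (a y)\<close>.
      The first factor is near \<open>e\<close> for \<open>x\<close> in \<open>A\<close>, costing at
      most \<open>1/3\<close> by \<open>osc\<close>; \<open>B\<close> bounds \<open>f\<close> at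
      \<open>a y\<close> by \<open>1/3\<close>, using continuity in one variable only.\<close>
    define A where "A = {x \<in> topspace X. ?m x (i a) \<in> V}"
    define B where "B = {y \<in> topspace X. f (?m a y) \<in> {..<1/3}}"
    have A: "openin X A"
      unfolding A_def by (rule openin_continuous_map_preimage[OF rc[OF inv(1)[OF a]] V(1)])
    have "continuous_map X euclideanreal (\<lambda>y. f (?m a y))"
      using continuous_map_compose[OF lc[OF a] f(1)] by (simp add: comp_def)
    then have B: "openin X B"
      unfolding B_def by (rule openin_continuous_map_preimage) simp
    have "?m x y \<in> W \<inter> G" if "x \<in> A \<inter> G" "y \<in> B \<inter> G" for x y
    proof -
      let ?v = "?m x (i a)"
      have eq: "?m ?v (?m a y) = ?m x y"
        using that a inv closed unit by (simp add: assoc flip: assoc[of "i a" a])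
      have "\<bar>f (?m ?v (?m a y)) - f (?m a y)\<bar> \<le> 1/3"
        using that a inv closed by (intro osc) (auto simp: A_def)
      moreover have "f (?m a y) < 1/3" using that by (simp add: B_def)
      ultimately have "f (?m x y) < 1" unfolding eq by linarith
      then show ?thesis using that fW closed GS by blast
    qed
    moreover have "openin (prod_topology (subtopology X G) (subtopology X G)) ((A \<inter> G) \<times> (B \<inter> G))"
      using A B by (simp add: openin_prod_Times_iff openin_subtopology_Int)
    moreover have "p \<in> (A \<inter> G) \<times> (B \<inter> G)"
      using a b GS inv V f by (auto simp: p A_def B_def)
    ultimately show "\<exists>U. openin (prod_topology (subtopology X G) (subtopology X G)) U \<and> p \<in> U \<and>
        (\<forall>q\<in>U. (case q of (x, y) \<Rightarrow> ?m x y) \<in> W')"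
      unfolding W(2) by (intro exI[of _ "(A \<inter> G) \<times> (B \<inter> G)"]) auto
  qed

  have inverse: "continuous_map (subtopology X G) (subtopology X G) i"
    unfolding continuous_map_eq_topcontinuous_at topcontinuous_at_def topG
  proof (intro ballI conjI allI impI)
    fix a assume a: "a \<in> G"
    show "a \<in> G" by fact
    show "i \<in> G \<rightarrow> G" using inv by blast
    fix W' assume "openin (subtopology X G) W' \<and> i a \<in> W'"
    then obtain W where W: "openin X W" "W' = W \<inter> G" "i a \<in> W"
      by (auto simp: openin_subtopology)
    obtain f where f: "continuous_map X euclideanreal f" "f (i a) = 0"
      and fW: "\<And>x. x \<in> topspace X \<Longrightarrow> f x < 1 \<Longrightarrow> x \<in> W"
      using sep[OF W(1,3)] by blast
    obtain V where V: "openin X V" "e \<in> V"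
      and osc: "\<And>v y. v \<in> V \<inter> G \<Longrightarrow> y \<in> G \<Longrightarrow> \<bar>f (?m v y) - f y\<bar> \<le> 1/3"
      using small[OF f(1)] by blast
    \<comment> \<open>For \<open>x\<close> in \<open>A\<close> the element \<open>?m (i a) x\<close>
      is near \<open>e\<close> and multiplies \<open>i x\<close> to \<open>i a\<close>. Since
      \<open>osc\<close> is uniform in \<open>y\<close>, it applies at \<open>y = i x\<close>,
      although nothing is known yet about the position of \<open>i x\<close>.\<close>
    define A where "A = {x \<in> topspace X. ?m (i a) x \<in> V}"
    have A: "openin X A"
      unfolding A_def by (rule openin_continuous_map_preimage[OF lc[OF inv(1)[OF a]] V(1)])
    have "i x \<in> W \<inter> G" if "x \<in> A \<inter> G" for x
    proof -
      let ?v = "?m (i a) x"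
      have eq: "?m ?v (i x) = i a"
        using that a inv unit by (simp add: assoc)
      have "\<bar>f (?m ?v (i x)) - f (i x)\<bar> \<le> 1/3"
        using that a inv closed by (intro osc) (auto simp: A_def)
      then have "f (i x) < 1" unfolding eq f(2) by linarith
      then show ?thesis using that fW inv GS by blast
    qed
    moreover have "openin (subtopology X G) (A \<inter> G)" using A by (rule openin_subtopology_Int)
    moreover have "a \<in> A \<inter> G" using a GS inv V by (auto simp: A_def)
    ultimately show "\<exists>U. openin (subtopology X G) U \<and> a \<in> U \<and> (\<forall>x\<in>U. i x \<in> W')"
      unfolding W(2) by blast
  qed

  show ?thesis
  proof
    show "topspace (subtopology X G) = carrier ?G" using topG by simp
    show "continuous_map (prod_topology (subtopology X G) (subtopology X G)) (subtopology X G)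
        (\<lambda>(x, y). x \<otimes>\<^bsub>?G\<^esub> y)"
      using mult by simp
    show "continuous_map (subtopology X G) (subtopology X G) (\<lambda>x. inv\<^bsub>?G\<^esub> x)"
      using inverse by (simp add: i_def)
  qed
qed

end
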